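(* Let $T$ and $U$ be two plane trees with the same even number $n$ of vertices. If $T$ and $U$ have different parities, then the rotation groups of the clean bipartite trees $T^c$ and $U^c$ are different: for any enumerations of the edges of $T^c$ and of $U^c$ by $1,\dots,2n-2$, the subgroups $R(T^c)$ and $R(U^c)$ of $S_{2n-2}$ do not coincide.
   Context: A plane tree is a finite tree embedded in the plane (equivalently, a tree with a cyclic counterclockwise order on the edges at each vertex). Parity: a pr-tree (plane rooted tree) is obtained from a plane tree by choosing a root vertex and a marked edge incident to the root. The children of each vertex are ordered from left to right: at the root, the edges are taken in counterclockwise order starting from the marked edge, and at any other vertex the edges to children are taken in counterclockwise order starting just after the edge to the parent. The bracket code of a pr-tree whose root has pr-subtrees $T_1,\dots,T_s$ (left to right) is recursively $(\,c(T_1)\cdots c(T_s)\,)$, where $c(T_i)$ is the code of $T_i$, and the one-vertex tree has code $()$. An inversion in a bracket code is a pair consisting of a closing bracket and an opening bracket, not necessarily adjacent, such that the closing bracket occurs before the opening bracket. A pr-tree is even if the number of inversions in its bracket code is even, and odd otherwise. For a plane tree with an even number of vertices this parity does not depend on the choice of root vertex and marked edge, so one speaks of even and odd plane trees. Rotation group: a bipartite tree is a tree with vertices colored black and white such that adjacent vertices have different colors. Let $T$ be a plane bipartite tree with $m$ edges enumerated by $M=\{1,\dots,m\}$. The permutation $s_w:M\to M$ is defined by $s_w(i)=j$ if the $i$-th and $j$-th edges are incident to the same white vertex $v$ and the $j$-th edge is the next after the $i$-th edge in going counterclockwise around $v$ (so $s_w(i)=i$ if $v$ has degree 1). The permutation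 $s_b$ is defined in the same way with respect to black vertices. The rotation group is $R(T)=\langle s_w,s_b\rangle\subset S_m$. Different enumerations of the edges give conjugate rotation groups. Clean tree: a bipartite tree is clean if all its black vertices have degree two. For a plane tree $T$, the clean plane bipartite tree $T^c$ is obtained by coloring all vertices of $T$ white and dividing each edge of $T$ into two edges by a new black vertex. If $T$ has $n$ vertices, $T^c$ has $2n-2$ edges. *)

theory Defs
  imports "HOL-Algebra.Sym_Groups" "HOL-Algebra.Generated_Groups" "HOL-Combinatorics.Orbits"
begin

section \<open>Plane trees\<close>

text \<open>
  A plane tree is given combinatorially: a simple graph together with a rotation system, where
  \<open>nxt T v e\<close> is the edge that follows \<open>e\<close> in counterclockwise order around its endpoint \<open>v\<close>.
  Only the values of \<open>nxt T v e\<close> for \<open>e\<close> an edge incident to \<open>v\<close> matter.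
\<close>

record 'v plane_graph =
  verts :: "'v set"
  edges :: "'v set set"
  nxt :: "'v \<Rightarrow> 'v set \<Rightarrow> 'v set"

definition incident :: "('v, 'm) plane_graph_scheme \<Rightarrow> 'v \<Rightarrow> 'v set set" where
  "incident T v = {e \<in> edges T. v \<in> e}"

definition simple_graph :: "'v set \<Rightarrow> 'v set set \<Rightarrow> bool" where
  "simple_graph V E \<longleftrightarrow> (\<forall>e\<in>E. \<exists>u\<in>V. \<exists>v\<in>V. u \<noteq> v \<and> e = {u, v})"

definition connected_graph :: "'v set \<Rightarrow> 'v set set \<Rightarrow> bool" where
  "connected_graph V E \<longleftrightarrow> V \<noteq> {} \<and> (\<forall>u\<in>V. \<forall>v\<in>V. (u, v) \<in> {(x, y). {x, y} \<in> E}\<^sup>*)"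

definition graph_cycle :: "'v set set \<Rightarrow> 'v list \<Rightarrow> bool" where
  "graph_cycle E vs \<longleftrightarrow> 3 \<le> length vs \<and> distinct vs \<and>
     (\<forall>i<length vs. {vs ! i, vs ! (Suc i mod length vs)} \<in> E)"

definition finite_tree :: "'v set \<Rightarrow> 'v set set \<Rightarrow> bool" where
  "finite_tree V E \<longleftrightarrow>
     finite V \<and> simple_graph V E \<and> connected_graph V E \<and> (\<nexists>vs. graph_cycle E vs)"

text \<open>The one-vertex tree has no edges around its vertex, hence the guard in the second conjunct.\<close>

definition plane_tree :: "('v, 'm) plane_graph_scheme \<Rightarrow> bool" where
  "plane_tree T \<longleftrightarrow> finite_tree (verts T) (edges T) \<and>
     (\<forall>v\<in>verts T. incident T v \<noteq> {} \<longrightarrow> cyclic_on (nxt T v) (incident T v))"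

section \<open>Parity\<close>

datatype pr_tree = PR_Node (pr_subtrees: "pr_tree list")

datatype bracket = Opening | Closing

primrec bracket_code :: "pr_tree \<Rightarrow> bracket list" where
  "bracket_code (PR_Node ts) = Opening # concat (map bracket_code ts) @ [Closing]"

definition inversions :: "bracket list \<Rightarrow> (nat \<times> nat) set" where
  "inversions w = {(i, j). i < j \<and> j < length w \<and> w ! i = Closing \<and> w ! j = Opening}"

definition even_pr_tree :: "pr_tree \<Rightarrow> bool" where
  "even_pr_tree t \<longleftrightarrow> even (card (inversions (bracket_code t)))"

definition odd_pr_tree :: "pr_tree \<Rightarrow> bool" where
  "odd_pr_tree t \<longleftrightarrow> odd (card (inversions (bracket_code t)))"

text \<open>
  \<open>pr_branch T w e t\<close>: the part of \<open>T\<close> consisting of \<open>w\<close> and its descendants, where the edge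
  \<open>e\<close> leads from \<open>w\<close> to its parent, is the ordered tree \<open>t\<close>. The edges to the children of \<open>w\<close> are
  \<open>nxt T w e\<close>, \<open>nxt T w (nxt T w e)\<close>, and so on, up to but excluding the return to \<open>e\<close>.
\<close>

inductive pr_branch :: "('v, 'm) plane_graph_scheme \<Rightarrow> 'v \<Rightarrow> 'v set \<Rightarrow> pr_tree \<Rightarrow> bool"
  for T where
  "list_all2 (\<lambda>e' t'. \<exists>w'. w' \<noteq> w \<and> e' = {w, w'} \<and> pr_branch T w' e' t')
     (map (\<lambda>i. (nxt T w ^^ i) e) [1..<card (incident T w)]) ts
   \<Longrightarrow> pr_branch T w e (PR_Node ts)"

text \<open>
  \<open>pr_tree_of T r e t\<close>: \<open>t\<close> is the pr-tree obtained from \<open>T\<close> by choosing the root \<open>r\<close> and the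
  marked edge \<open>e\<close>. Here \<open>e\<close> itself leads to the first child.
\<close>

definition pr_tree_of ::
  "('v, 'm) plane_graph_scheme \<Rightarrow> 'v \<Rightarrow> 'v set \<Rightarrow> pr_tree \<Rightarrow> bool" where
  "pr_tree_of T r e t \<longleftrightarrow> r \<in> verts T \<and> e \<in> incident T r \<and>
     list_all2 (\<lambda>e' t'. \<exists>w'. w' \<noteq> r \<and> e' = {r, w'} \<and> pr_branch T w' e' t')
       (map (\<lambda>i. (nxt T r ^^ i) e) [0..<card (incident T r)]) (pr_subtrees t)"

text \<open>
  For an even number of vertices all choices of root and marked edge give the same parity. The
  existential form of both definitions makes ``\<open>T\<close> is even and \<open>U\<close> is odd'' as weak a hypothesis
  as possible, without building this independence into the definitions.
\<close>

definition even_plane_tree :: "('v, 'm) plane_graph_scheme \<Rightarrow> bool" where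
  "even_plane_tree T \<longleftrightarrow> (\<exists>r e t. pr_tree_of T r e t \<and> even_pr_tree t)"

definition odd_plane_tree :: "('v, 'm) plane_graph_scheme \<Rightarrow> bool" where
  "odd_plane_tree T \<longleftrightarrow> (\<exists>r e t. pr_tree_of T r e t \<and> odd_pr_tree t)"

section \<open>Rotation groups and clean trees\<close>

record 'v plane_bipartite_graph = "'v plane_graph" +
  white :: "'v set"

definition black :: "('v, 'm) plane_bipartite_graph_scheme \<Rightarrow> 'v set" where
  "black B = verts B - white B"

text \<open>
  An enumeration of the edges is a bijection \<open>f\<close> from the edges onto \<open>{1..m}\<close>. The permutation
  defined by the vertices in a colour class \<open>C\<close> is the identity outside \<open>{1..m}\<close>, so that it
  is an element of \<^const>\<open>sym_group\<close>.
\<close>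

definition colour_perm ::
  "('v, 'm) plane_graph_scheme \<Rightarrow> 'v set \<Rightarrow> ('v set \<Rightarrow> nat) \<Rightarrow> nat \<Rightarrow> nat" where
  "colour_perm B C f i =
     (if i \<in> f ` edges B
      then THE j. \<exists>v\<in>C. \<exists>e\<in>incident B v. f e = i \<and> f (nxt B v e) = j
      else i)"

definition rotation_group ::
  "('v, 'm) plane_bipartite_graph_scheme \<Rightarrow> ('v set \<Rightarrow> nat) \<Rightarrow> (nat \<Rightarrow> nat) set" where
  "rotation_group B f =
     generate (sym_group (card (edges B))) {colour_perm B (white B) f, colour_perm B (black B) f}"

text \<open>
  In the clean tree of \<open>T\<close> the white vertices are \<open>Inl v\<close> for the vertices \<open>v\<close> of \<open>T\<close>, and
  the black vertices are \<open>Inr e\<close> for the edges \<open>e\<close> of \<open>T\<close>. An edge \<open>e = {u, v}\<close> of \<open>T\<close> is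
  divided into \<open>{Inl u, Inr e}\<close> and \<open>{Inl v, Inr e}\<close>, which \<open>nxt\<close> interchanges at \<open>Inr e\<close>.
\<close>

definition clean_tree ::
  "('v, 'm) plane_graph_scheme \<Rightarrow> ('v + 'v set) plane_bipartite_graph" where
  "clean_tree T =
     \<lparr> verts = Inl ` verts T \<union> Inr ` edges T,
       edges = {{Inl v, Inr e} | v e. e \<in> edges T \<and> v \<in> e},
       nxt = (\<lambda>x h. case x of
                Inl v \<Rightarrow> {Inl v, Inr (nxt T v (THE e. Inr e \<in> h))}
              | Inr e \<Rightarrow> {Inl (THE v. v \<in> e \<and> Inl v \<notin> h), Inr e}),
       white = Inl ` verts T \<rparr>"

end

theory Submission
  imports Defs
begin

text \<open>
  Colour the vertices of \<open>T\<close> properly with two colours and let \<open>p\<close> be the number of vertices of one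
  colour. By induction on ordered trees, the number of inversions of a bracket code is congruent to
  \<open>n choose 2\<close> plus the number of vertices at odd depth, so for even \<open>n\<close> the parity of \<open>T\<close> is that of
  \<open>(n choose 2) + p\<close>.

  The edges of \<open>T\<^sup>c\<close> at the vertices of one colour form a block \<open>A\<close> of odd size \<open>n - 1\<close>: it is
  preserved by \<open>s\<^sub>w\<close> and exchanged with its complement by \<open>s\<^sub>b\<close>. On \<open>A\<close>, the permutation \<open>s\<^sub>w\<close>
  has \<open>p\<close> cycles, hence sign \<open>(-1)^(n - 1 - p)\<close>, and it has the same sign on the complement
  because \<open>n\<close> is even. So the elements of the rotation group that preserve \<open>A\<close> all act evenly on \<open>A\<close>
  if and only if \<open>p\<close> is odd. As the group is transitive and \<open>n - 1\<close> is odd, the partition into the two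
  blocks is determined by the group, and so is the parity of \<open>p\<close>.
\<close>

section \<open>Signs of permutations\<close>

lemma cyclic_on_enumeration:
  assumes "cyclic_on f S" "x \<in> S"
  shows "bij_betw (\<lambda>i. (f ^^ i) x) {0..<card S} S" and "(f ^^ card S) x = x"
proof -
  have orb: "orbit f x = S" and x: "x \<in> orbit f x"
    using assms orbit_cyclic_eq3 by fastforce+
  have inj: "inj_on (\<lambda>i. (f ^^ i) x) {0..<funpow_dist1 f x x}"
    by (rule inj_on_funpow_dist1[OF x])
  have im: "S = (\<lambda>i. (f ^^ i) x) ` {0..<funpow_dist1 f x x}"
    using orbit_conv_funpow_dist1[OF x] orb by simp
  then have card: "card S = funpow_dist1 f x x"
    using card_image[OF inj] by simp
  show "bij_betw (\<lambda>i. (f ^^ i) x) {0..<card S} S"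
    using inj im unfolding card bij_betw_def by simp
  show "(f ^^ card S) x = x"
    unfolding card by (rule funpow_dist1_prop[OF x])
qed

text \<open>\<open>cyclic_on\<close> does not assume injectivity. Every point returns to itself
  under iteration, so it is the image of its predecessor; a surjection of a finite set onto itself
  is injective.\<close>

lemma cyclic_on_bij_betw:
  assumes "cyclic_on f S"
  shows "bij_betw f S S"
proof -
  have "S \<subseteq> f ` S"
  proof
    fix y assume y: "y \<in> S"
    then have "y \<in> orbit f y" using assms orbit_cyclic_eq3 by fastforce
    then obtain k where "0 < k" "(f ^^ k) y = y" unfolding orbit_altdef by auto
    then obtain k where "(f ^^ Suc k) y = y" using gr0_implies_Suc by blast
    then show "y \<in> f ` S"
      using cyclic_on_funpow_in[OF assms y, of k] by (metis funpow.simps(2) image_eqI o_apply)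
  qed
  moreover have "f ` S \<subseteq> S" using cyclic_on_inI[OF assms] by auto
  ultimately have "f ` S = S" by blast
  then show ?thesis
    using eq_card_imp_inj_on[OF finite_cyclic_on[OF assms], of f] by (simp add: bij_betw_def)
qed

text \<open>\<open>cycle_of_list\<close> peels off one transposition per element after the first.
  Writing \<open>- ((-1) ^ length cs)\<close> avoids the subtraction in
  \<open>length cs - 1\<close>.\<close>

lemma sign_cycle_of_list:
  assumes "distinct cs" "cs \<noteq> []"
  shows "sign (cycle_of_list cs) = - ((-1) ^ length cs)"
  using assms
proof (induction cs rule: cycle_of_list.induct)
  case (1 i j cs)
  then have signs: "sign (transpose i j) = -1" "sign (cycle_of_list (j # cs)) = - ((-1) ^ length (j # cs))"
    by (auto simp: sign_swap_id)
  have "sign (cycle_of_list (i # j # cs)) = sign (transpose i j) * sign (cycle_of_list (j # cs))"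
    unfolding cycle_of_list.simps by (intro sign_compose permutation_swap_id permutation_of_cycle)
  also have "\<dots> = - ((-1) ^ length (i # j # cs))"
    unfolding signs by simp
  finally show ?case .
qed simp_all

text \<open>On \<open>S\<close> the map agrees with the cycle that lists an orbit, and
  \<open>sign_on\<close> ignores the values outside \<open>S\<close>.\<close>

lemma sign_on_cyclic:
  assumes "cyclic_on f S"
  shows "sign_on S f = - ((-1) ^ card S)"
proof -
  obtain x where x: "x \<in> S" using assms unfolding cyclic_on_def by blast
  define cs where "cs = map (\<lambda>i. (f ^^ i) x) [0..<card S]"
  have set_cs: "set cs = S"
    using cyclic_on_enumeration(1)[OF assms x] unfolding cs_def bij_betw_def by simp
  have dist: "distinct cs"
    using cyclic_on_enumeration(1)[OF assms x] unfolding cs_def bij_betw_def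
    by (simp add: distinct_map)
  have len: "length cs = card S" unfolding cs_def by simp
  have "f y = cycle_of_list cs y" if "y \<in> S" for y
  proof -
    obtain i where i: "i < card S" "y = cs ! i"
      using \<open>y \<in> S\<close> set_cs len by (metis in_set_conv_nth)
    have "cycle_of_list cs y = map (cycle_of_list cs) cs ! i"
      using i len by simp
    also have "\<dots> = rotate1 cs ! i"
      using cyclic_rotation[OF dist, of 1] by simp
    also have "\<dots> = cs ! (Suc i mod card S)"
      using i len by (simp add: nth_rotate1)
    also have "\<dots> = (f ^^ (Suc i mod card S)) x"
      using i(1) unfolding cs_def by simp
    \<comment> \<open>At the last index the list wraps to position 0, and
      \<open>(f ^^ card S) x = x\<close> accounts for it.\<close>
    also have "\<dots> = (f ^^ Suc i) x"
      using i(1) cyclic_on_enumeration(2)[OF assms x]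
      by (cases "Suc i = card S") auto
    also have "\<dots> = f y" using i unfolding cs_def by simp
    finally show ?thesis ..
  qed
  then have "sign_on S f = sign_on S (cycle_of_list cs)" by (intro sign_on_cong) auto
  also have "\<dots> = sign (cycle_of_list cs)"
    using cycle_permutes[of cs] set_cs by (intro sign_on_permutes[of _ S]) auto
  also have "\<dots> = - ((-1) ^ card S)"
    using sign_cycle_of_list[OF dist] set_cs x len by fastforce
  finally show ?thesis .
qed

text \<open>Extended by the identity, the restrictions to the disjoint sets \<open>A\<close> and
  \<open>B\<close> compose to the restriction to their union, and \<open>sign\<close> is
  multiplicative.\<close>

lemma sign_on_Un:
  assumes "bij_betw f A A" "bij_betw f B B" "A \<inter> B = {}" "finite A" "finite B"
  shows "sign_on (A \<union> B) f = sign_on A f * sign_on B f"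
proof -
  have "restrict_id f (A \<union> B) = restrict_id f A \<circ> restrict_id f B"
    using assms(1-3) by (auto simp: fun_eq_iff restrict_id_def bij_betw_def)
  then show ?thesis
    unfolding sign_on_def
    by (simp add: sign_compose permutes_imp_permutation[OF _ permutes_restrict_id] assms)
qed

text \<open>A cycle of length l has sign (-1)^(l + 1), so the exponent adds up all lengths and the
  number of cycles. Bijectivity is carried along because \<open>sign_on_Un\<close> asks for
  it.\<close>

lemma sign_on_UN_cyclic:
  assumes "finite I" "\<And>i. i \<in> I \<Longrightarrow> cyclic_on f (S i)" "disjoint_family_on S I"
  shows "bij_betw f (\<Union>i\<in>I. S i) (\<Union>i\<in>I. S i) \<and>
         sign_on (\<Union>i\<in>I. S i) f = (-1) ^ (card (\<Union>i\<in>I. S i) + card I)"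
  using assms
proof (induction I rule: finite_induct)
  case empty
  show ?case by (simp add: sign_on_def restrict_id_def bij_betw_def)
next
  case (insert i I)
  let ?U = "\<Union>j\<in>I. S j"
  have IH: "bij_betw f ?U ?U" "sign_on ?U f = (-1) ^ (card ?U + card I)"
    using insert by (auto intro: disjoint_family_on_mono[of I "insert i I"])
  have cyc: "cyclic_on f (S i)" using insert.prems by simp
  note bij = cyclic_on_bij_betw[OF cyc]
  have disj: "S i \<inter> ?U = {}"
    using insert.prems(2) insert.hyps(2) by (auto simp: disjoint_family_on_def)
  have fin: "finite (S i)" "finite ?U"
    using insert.prems(1) insert.hyps(1) by (auto intro: finite_cyclic_on)
  have "bij_betw f (S i \<union> ?U) (S i \<union> ?U)"
    using bij_betw_combine[OF bij IH(1) disj] .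
  moreover have "sign_on (S i \<union> ?U) f = (-1) ^ (card (S i \<union> ?U) + card (insert i I))"
    using sign_on_Un[OF bij IH(1) disj fin] sign_on_cyclic[OF cyc] IH(2) insert.hyps
    by (simp add: card_Un_disjoint[OF fin disj] power_add)
  ultimately show ?case by simp
qed

text \<open>The sign of \<open>b\<close> enters twice, from \<open>b\<close> and from its inverse,
  and cancels.\<close>

lemma sign_on_conjugate:
  assumes "permutation b" "bij_betw a B B" "finite B"
  shows "sign_on (b ` B) (b \<circ> a \<circ> inv' b) = sign_on B a"
proof -
  have bij: "bij b" using assms(1) by (rule permutation_bijective)
  have "restrict_id (b \<circ> a \<circ> inv' b) (b ` B) = b \<circ> restrict_id a B \<circ> inv' b"
  proof
    fix x
    obtain y where "x = b y" using bij by (metis bij_pointE)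
    then show "restrict_id (b \<circ> a \<circ> inv' b) (b ` B) x = (b \<circ> restrict_id a B \<circ> inv' b) x"
      using bij by (auto simp: restrict_id_def bij_is_inj inv_f_f inj_image_mem_iff)
  qed
  moreover have "permutation (restrict_id a B)"
    using assms by (intro permutes_imp_permutation[OF _ permutes_restrict_id])
  ultimately show ?thesis
    unfolding sign_on_def
    by (simp add: sign_compose sign_inverse permutation_compose permutation_inverse assms(1)
        mult.commute mult.left_commute)
qed

section \<open>Groups generated by two permutations with two blocks\<close>

text \<open>Abstract form of the rotation group: \<open>a\<close> turns around the white vertices,
  \<open>b\<close> around the black ones, and \<open>s\<close> is the common sign of
  \<open>a\<close> on the two halves. \<open>irreducible\<close> is transitivity, put as a condition
  on the generators alone.\<close>

locale swapped_blocks =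
  fixes m :: nat and A :: "nat set" and a b :: "nat \<Rightarrow> nat" and s :: int
  assumes a_permutes: "a permutes {1..m}"
    and b_permutes: "b permutes {1..m}"
    and b_involution: "b \<circ> b = id"
    and block_subset: "A \<subseteq> {1..m}"
    and a_block: "a ` A = A"
    and b_block: "b ` A = {1..m} - A"
    and sign_block: "sign_on A a = s"
    and sign_coblock: "sign_on ({1..m} - A) a = s"
    and odd_block: "odd (card A)"
    and irreducible: "\<And>S. S \<subseteq> {1..m} \<Longrightarrow> S \<noteq> {} \<Longrightarrow> a ` S \<subseteq> S \<Longrightarrow> b ` S \<subseteq> S \<Longrightarrow> S = {1..m}"
begin

abbreviation (input) M where "M \<equiv> {1..m}"

abbreviation grp where "grp \<equiv> generate (sym_group m) {a, b}"

section \<open>How the group acts on the two blocks\<close>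

lemma finite_block: "finite A"
  using block_subset finite_subset by blast

lemma a_coblock: "a ` (M - A) = M - A"
  using image_set_diff[OF permutes_inj[OF a_permutes], of M A] permutes_image[OF a_permutes] a_block by simp

lemma b_coblock: "b ` (M - A) = A"
  unfolding b_block[symmetric] by (simp add: image_comp b_involution)

lemma inv_b: "inv' b = b"
  using b_involution inv_unique_comp by blast

lemma block_ne_coblock: "A \<noteq> M - A"
proof
  assume "A = M - A"
  moreover obtain x where "x \<in> A" using odd_block by fastforce
  ultimately show False by (metis Diff_iff)
qed

text \<open>\<open>generate\<close> builds arbitrary products, whereas this rule peels single
  generators off the left. The inverse of \<open>b\<close> is \<open>b\<close> itself and has no
  case of its own.\<close>

lemma grp_induct [consumes 1, case_names id left_a left_a_inv left_b]:
  assumes "g \<in> grp"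
    and "P id"
    and "\<And>h. P h \<Longrightarrow> P (a \<circ> h)" "\<And>h. P h \<Longrightarrow> P (inv' a \<circ> h)" "\<And>h. P h \<Longrightarrow> P (b \<circ> h)"
  shows "P g"
proof -
  \<comment> \<open>Quantifying over the right factor makes the claim pass through products.\<close>
  have "\<forall>h. P h \<longrightarrow> P (g \<circ> h)"
    using assms(1)
  proof (induction g rule: generate.induct)
    case one
    then show ?case by (simp add: sym_group_one)
  next
    case (incl h)
    then show ?case using assms(3,5) by blast
  next
    case (inv h)
    then have "inv\<^bsub>sym_group m\<^esub> h = inv' h"
      using a_permutes b_permutes by (intro sym_group_inv_equality) (auto simp: sym_group_carrier)
    with inv assms(4,5) inv_b show ?case by (metis insertE singletonD)
  next
    case (eng g h)
    then show ?case by (simp add: sym_group_mult comp_assoc)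
  qed
  then show ?thesis using assms(2) by (metis comp_id)
qed

lemma inv_a_image: "a ` S = S \<Longrightarrow> inv' a ` S = S"
  using image_inv_f_f[OF permutes_inj[OF a_permutes], of S] by simp

lemma grp_block: "g \<in> grp \<Longrightarrow> g ` A = A \<or> g ` A = M - A"
proof (induction rule: grp_induct)
  case (left_a h)
  then show ?case by (metis image_comp a_block a_coblock)
next
  case (left_a_inv h)
  then show ?case by (metis image_comp inv_a_image a_block a_coblock)
next
  case (left_b h)
  then show ?case by (metis image_comp b_block b_coblock)
qed simp

text \<open>Evenness is demanded on both halves so that conjugation by \<open>b\<close>, which
  exchanges them, preserves the set.\<close>

definition even_stabilizer where
  "even_stabilizer = {h. h permutes M \<and> h ` A = A \<and> sign_on A h = 1 \<and> sign_on (M - A) h = 1}"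

lemma bij_betw_blocks:
  assumes "h permutes M" "h ` A = A"
  shows "bij_betw h A A" "bij_betw h (M - A) (M - A)"
proof -
  have "h ` (M - A) = M - A"
    using image_set_diff[OF permutes_inj[OF assms(1)], of M A] permutes_image[OF assms(1)] assms(2)
    by simp
  then show "bij_betw h A A" "bij_betw h (M - A) (M - A)"
    using assms permutes_inj[OF assms(1)] unfolding bij_betw_def
    by (auto intro: inj_on_subset)
qed

lemma even_stabilizer_comp:
  assumes "g \<in> even_stabilizer" "h \<in> even_stabilizer"
  shows "g \<circ> h \<in> even_stabilizer"
proof -
  have "sign_on A (g \<circ> h) = 1" "sign_on (M - A) (g \<circ> h) = 1"
    using assms sign_on_compose[of g A h] sign_on_compose[of g "M - A" h]
      bij_betw_blocks[of g] bij_betw_blocks[of h] finite_block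
    by (auto simp only: even_stabilizer_def mem_Collect_eq finite_Diff finite_atLeastAtMost)
  then show ?thesis
    using assms unfolding even_stabilizer_def
    by (auto simp only: mem_Collect_eq permutes_compose image_comp[symmetric])
qed

lemma even_stabilizer_inv:
  assumes "g \<in> even_stabilizer"
  shows "inv' g \<in> even_stabilizer"
proof -
  have g: "g permutes M" "g ` A = A" using assms by (auto simp: even_stabilizer_def)
  have i: "inv' g permutes M" "inv' g ` A = A"
    using g image_inv_f_f[OF permutes_inj[OF g(1)], of A] by (simp_all add: permutes_inv)
  have "g \<circ> inv' g = id" using g(1) by (rule permutes_inv_o)
  then have "sign_on A g * sign_on A (inv' g) = 1" "sign_on (M - A) g * sign_on (M - A) (inv' g) = 1"
    using sign_on_compose[OF bij_betw_blocks(1)[OF g] bij_betw_blocks(1)[OF i] finite_block]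
      sign_on_compose[OF bij_betw_blocks(2)[OF g] bij_betw_blocks(2)[OF i]]
    by simp_all
  then show ?thesis using assms i by (simp add: even_stabilizer_def)
qed

lemma even_stabilizer_conj:
  assumes "g \<in> even_stabilizer"
  shows "b \<circ> g \<circ> b \<in> even_stabilizer"
proof -
  have g: "g permutes M" "g ` A = A" using assms by (auto simp: even_stabilizer_def)
  have b: "permutation b" using b_permutes by (metis finite_atLeastAtMost permutation_permutes)
  have "sign_on (M - A) (b \<circ> g \<circ> b) = sign_on A g"
    using sign_on_conjugate[OF b bij_betw_blocks(1)[OF g] finite_block]
    unfolding inv_b b_block .
  moreover have "sign_on A (b \<circ> g \<circ> b) = sign_on (M - A) g"
    using sign_on_conjugate[OF b bij_betw_blocks(2)[OF g]] unfolding inv_b b_coblock by blast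
  moreover have "g ` (M - A) = M - A" using bij_betw_blocks(2)[OF g] by (simp add: bij_betw_def)
  ultimately show ?thesis
    using g(1) b_permutes assms unfolding even_stabilizer_def
    by (auto simp only: mem_Collect_eq permutes_compose image_comp[symmetric] b_block b_coblock)
qed

lemma a_even_stabilizer: "s = 1 \<Longrightarrow> a \<in> even_stabilizer"
  unfolding even_stabilizer_def using a_permutes a_block sign_block sign_coblock by simp

text \<open>The set \<open>even_stabilizer\<close> and its left coset by \<open>b\<close> are
  together stable under left multiplication by \<open>a\<close>, its inverse and
  \<open>b\<close>.\<close>

lemma grp_even_stabilizer:
  assumes "g \<in> grp" "s = 1"
  shows "g \<in> even_stabilizer \<or> b \<circ> g \<in> even_stabilizer"
  using assms(1)
proof (induction rule: grp_induct)
  case id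
  show ?case unfolding even_stabilizer_def
    by (intro disjI1 CollectI conjI permutes_id sign_on_id) simp
next
  have left: "c \<circ> h \<in> even_stabilizer \<or> b \<circ> (c \<circ> h) \<in> even_stabilizer"
    if c: "c \<in> even_stabilizer" and h: "h \<in> even_stabilizer \<or> b \<circ> h \<in> even_stabilizer" for c h
    using h
  proof
    assume "h \<in> even_stabilizer"
    then show ?thesis using even_stabilizer_comp c by blast
  next
    assume "b \<circ> h \<in> even_stabilizer"
    \<comment> \<open>Moving \<open>c\<close> past \<open>b\<close> replaces it by its conjugate,
      which again acts evenly on both halves.\<close>
    then have "(b \<circ> c \<circ> b) \<circ> (b \<circ> h) \<in> even_stabilizer"
      by (rule even_stabilizer_comp[OF even_stabilizer_conj[OF c]])
    also have "(b \<circ> c \<circ> b) \<circ> (b \<circ> h) = b \<circ> (c \<circ> h)"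
      using b_involution by (simp add: fun_eq_iff)
    finally show ?thesis by blast
  qed
  case (left_a h)
  then show ?case using left a_even_stabilizer assms(2) by blast
  case (left_a_inv h)
  then show ?case using left even_stabilizer_inv a_even_stabilizer assms(2) by blast
next
  case (left_b h)
  have "b \<circ> (b \<circ> h) = h" using b_involution by (simp add: fun_eq_iff)
  with left_b show ?case by metis
qed

text \<open>If \<open>b \<circ> g\<close> stabilised \<open>A\<close> as \<open>g\<close> does, so
  would \<open>b\<close>, which instead moves \<open>A\<close> to its complement. Only the first
  alternative of \<open>grp_even_stabilizer\<close> remains.\<close>

lemma sign_on_stabilizer:
  assumes "g \<in> grp" "s = 1" "g ` A = A"
  shows "sign_on A g = 1"
proof -
  have "b \<circ> g \<notin> even_stabilizer"
  proof
    assume "b \<circ> g \<in> even_stabilizer"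
    then have "b ` (g ` A) = A" unfolding even_stabilizer_def image_comp by blast
    then show False using assms(3) b_block block_ne_coblock by simp
  qed
  then show ?thesis
    using grp_even_stabilizer[OF assms(1,2)] by (auto simp: even_stabilizer_def)
qed

text \<open>
  A generator that did not act in the same way on both block systems would exchange the parts of a
  block inside and outside the other system's block, so a block would have even size.
\<close>

lemma block_unique:
  assumes "A' \<subseteq> M" and "odd (card A')"
    and "a ` A' = A' \<or> a ` A' = M - A'" and "b ` A' = A' \<or> b ` A' = M - A'"
  shows "A' = A \<or> A' = M - A"
proof -
  have split: "card (A \<inter> A') + card (A \<inter> (M - A')) = card A"
    using card_Int_Diff[OF finite_block, of A'] block_subset
    by (simp add: Int_Diff[symmetric] Int_absorb2)
  have injs: "inj a" "inj b" using a_permutes b_permutes permutes_inj by auto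
  have a': "a ` A' = A'"
  proof (rule ccontr)
    assume "\<not> ?thesis"
    then have "a ` (A \<inter> A') = A \<inter> (M - A')"
      using assms(3) a_block injs by (simp add: image_Int)
    then have "card (A \<inter> A') = card (A \<inter> (M - A'))"
      using injs card_image by (metis inj_on_subset subset_UNIV)
    then show False using split odd_block by presburger
  qed
  have b': "b ` A' = M - A'"
  proof (rule ccontr)
    assume "\<not> ?thesis"
    then have "b ` A' = A'" using assms(4) by simp
    then have "b ` (A \<inter> A') = (M - A) \<inter> A'"
      using b_block injs by (simp add: image_Int)
    then have "card (A \<inter> A') = card ((M - A) \<inter> A')"
      using injs card_image by (metis inj_on_subset subset_UNIV)
    moreover have "card A' = card (A' \<inter> A) + card (A' - A)"
      using assms(1) finite_subset by (intro card_Int_Diff) blast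
    moreover have "(M - A) \<inter> A' = A' - A" using assms(1) by blast
    ultimately show False using assms(2) by (simp add: Int_commute)
  qed
  \<comment> \<open>The set where membership in \<open>A\<close> and in \<open>A'\<close> agrees is
    invariant under both generators, hence empty or all of \<open>M\<close>; these are the two
    alternatives of the claim.\<close>
  let ?S = "{x \<in> M. x \<in> A \<longleftrightarrow> x \<in> A'}"
  have "?S = M" if "?S \<noteq> {}"
  proof (rule irreducible[OF _ that])
    show "a ` ?S \<subseteq> ?S"
    proof clarify
      fix x assume "x \<in> M" "x \<in> A \<longleftrightarrow> x \<in> A'"
      moreover have "a x \<in> A \<longleftrightarrow> x \<in> A" "a x \<in> A' \<longleftrightarrow> x \<in> A'"
        using a' a_block injs by (metis inj_image_mem_iff)+
      ultimately show "a x \<in> M \<and> (a x \<in> A \<longleftrightarrow> a x \<in> A')"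
        using permutes_in_image[OF a_permutes] by blast
    qed
    show "b ` ?S \<subseteq> ?S"
    proof clarify
      fix x assume "x \<in> M" "x \<in> A \<longleftrightarrow> x \<in> A'"
      moreover have "b x \<in> M - A \<longleftrightarrow> x \<in> A" "b x \<in> M - A' \<longleftrightarrow> x \<in> A'"
        using b' b_block injs by (metis inj_image_mem_iff)+
      ultimately show "b x \<in> M \<and> (b x \<in> A \<longleftrightarrow> b x \<in> A')"
        using permutes_in_image[OF b_permutes] by blast
    qed
  qed auto
  then show ?thesis using assms(1) block_subset by blast
qed

end

text \<open>The blocks of equal groups agree up to complement, so \<open>a'\<close> is an element of
  the first group that stabilises \<open>A\<close> and acts on it with sign \<open>s\<close>; as
  \<open>a\<close> has sign 1, every such element acts evenly.\<close>

lemma rotation_sign_unique: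
  assumes T: "swapped_blocks m A a b 1" and U: "swapped_blocks m A' a' b' s"
    and eq: "generate (sym_group m) {a, b} = generate (sym_group m) {a', b'}"
  shows "s = 1"
proof -
  interpret T: swapped_blocks m A a b 1 by (rule T)
  interpret U: swapped_blocks m A' a' b' s by (rule U)
  have "a \<in> U.grp" "b \<in> U.grp"
    unfolding eq[symmetric] by (auto intro: generate.incl)
  then have "A' = A \<or> A' = {1..m} - A"
    using T.block_unique[OF U.block_subset U.odd_block] U.grp_block by simp
  then have A: "A = A' \<or> A = {1..m} - A'"
    using T.block_subset by blast
  then have "a' ` A = A" "sign_on A a' = s"
    using U.a_block U.a_coblock U.sign_block U.sign_coblock by auto
  moreover have "a' \<in> T.grp"
    unfolding eq by (auto intro: generate.incl)
  ultimately show ?thesis using T.sign_on_stabilizer by simp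
qed

section \<open>Parity of ordered trees\<close>

text \<open>The nodes at even depth are counted for \<open>k = True\<close>, those at odd depth for \<open>k = False\<close>.\<close>

primrec level_nodes :: "pr_tree \<Rightarrow> bool \<Rightarrow> nat" where
  "level_nodes (PR_Node ts) k = of_bool k + sum_list (map (\<lambda>h. h (\<not> k)) (map level_nodes ts))"

definition nodes :: "pr_tree \<Rightarrow> nat" where
  "nodes t = level_nodes t True + level_nodes t False"

text \<open>Pairs lie inside one part or have one element in each. The mixed term
  \<open>a * b\<close> is later matched with the inversions between the codes of different
  subtrees.\<close>

lemma choose_two_add: "(a + b) choose 2 = (a choose 2) + (b choose 2) + a * b"
  by (induction a) (simp_all add: numeral_2_eq_2)

section \<open>Counting inversions and brackets\<close>

lemma finite_inversions: "finite (inversions w)"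
  by (rule finite_subset[of _ "{..<length w} \<times> {..<length w}"]) (auto simp: inversions_def)

text \<open>A closing bracket put in front forms an inversion with every opening bracket behind it;
  all other inversions only shift by one index.\<close>

lemma card_inversions_Cons:
  "card (inversions (x # w)) =
     card (inversions w) + (if x = Closing then count_list w Opening else 0)"
proof -
  let ?S = "if x = Closing then {j. j < length w \<and> w ! j = Opening} else {}"
  have eq: "inversions (x # w) = map_prod Suc Suc ` inversions w \<union> (\<lambda>j. (0, Suc j)) ` ?S"
    (is "?L = ?R")
  proof (intro equalityI subsetI)
    fix p assume p: "p \<in> ?L"
    obtain i j where ij: "p = (i, j)" by (cases p)
    then obtain j' where "j = Suc j'" using p by (cases j) (auto simp: inversions_def)
    then show "p \<in> ?R" using p ij by (cases i) (force simp: inversions_def)+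
  qed (auto simp: inversions_def split: if_splits)
  have "count_list w Opening = card {j. j < length w \<and> w ! j = Opening}"
    by (simp add: count_list_eq_length_filter length_filter_conv_card eq_commute)
  moreover have "card (map_prod Suc Suc ` inversions w) = card (inversions w)"
    by (intro card_image inj_onI) auto
  moreover have "card ((\<lambda>j. (0::nat, Suc j)) ` ?S) = card ?S"
    by (intro card_image inj_onI) auto
  ultimately show ?thesis
    unfolding eq by (subst card_Un_disjoint) (auto simp: finite_inversions)
qed

lemma card_inversions_append:
  "card (inversions (u @ v)) =
     card (inversions u) + card (inversions v) + count_list u Closing * count_list v Opening"
proof (induction u)
  case Nil
  have "inversions [] = {}" by (auto simp: inversions_def)
  then show ?case by simp
next
  case (Cons x u)
  then show ?case by (simp add: card_inversions_Cons)
qed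

lemma count_list_concat: "count_list (concat ws) x = sum_list (map (\<lambda>w. count_list w x) ws)"
  by (induction ws) simp_all

lemma nodes_PR_Node: "nodes (PR_Node ts) = Suc (sum_list (map nodes ts))"
  by (induction ts) (simp_all add: nodes_def)

lemma count_bracket_code:
  "count_list (bracket_code t) x = nodes t"
proof (induction t)
  case (PR_Node ts)
  then have "sum_list (map (\<lambda>t. count_list (bracket_code t) x) ts) = sum_list (map nodes ts)"
    by (intro arg_cong[of _ _ sum_list]) simp
  then show ?case
    by (cases x) (simp_all add: nodes_PR_Node count_list_concat comp_def)
qed

text \<open>Joining codes adds the same product of node counts to the inversions and to the binomial
  coefficient. Adding the root raises the binomial coefficient by \<open>?n\<close>, which offsets
  modulo 2 that all depths grow by one.\<close>

lemma inversions_bracket_code_parity: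
  "even (card (inversions (bracket_code t)) + (nodes t choose 2) + level_nodes t False)"
proof (induction t)
  case (PR_Node ts)
  let ?w = "concat (map bracket_code ts)" and ?n = "sum_list (map nodes ts)"
  have count: "count_list ?w x = ?n" for x
    by (simp add: count_list_concat comp_def count_bracket_code)
  have "even (card (inversions ?w) + (?n choose 2) + sum_list (map (\<lambda>t. level_nodes t False) ts))"
    using PR_Node
  proof (induction ts)
    case Nil
    have "inversions [] = {}" by (auto simp: inversions_def)
    then show ?case by (simp add: numeral_2_eq_2)
  next
    case (Cons t ts)
    let ?k = "sum_list (map nodes ts)"
    have "count_list (concat (map bracket_code ts)) Opening = ?k"
      by (simp add: count_list_concat comp_def count_bracket_code)
    then have "card (inversions (concat (map bracket_code (t # ts)))) =
      card (inversions (bracket_code t)) + card (inversions (concat (map bracket_code ts)))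
        + nodes t * ?k"
      by (simp add: card_inversions_append count_bracket_code)
    moreover have "sum_list (map nodes (t # ts)) choose 2 = (nodes t choose 2) + (?k choose 2) + nodes t * ?k"
      by (simp add: choose_two_add)
    ultimately have "card (inversions (concat (map bracket_code (t # ts))))
        + (sum_list (map nodes (t # ts)) choose 2) + sum_list (map (\<lambda>t. level_nodes t False) (t # ts)) =
      (card (inversions (bracket_code t)) + (nodes t choose 2) + level_nodes t False)
        + (card (inversions (concat (map bracket_code ts))) + (?k choose 2)
          + sum_list (map (\<lambda>t. level_nodes t False) ts)) + 2 * (nodes t * ?k)"
      by simp
    moreover have "even \<dots>"
      by (intro dvd_add Cons.IH Cons.prems dvd_triv_left) simp_all
    ultimately show ?case by (simp only:)
  qed
  \<comment> \<open>The outer brackets enter no inversion: nothing precedes the opening one and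
    nothing follows the closing one.\<close>
  moreover have "card (inversions (bracket_code (PR_Node ts))) = card (inversions ?w)"
  proof -
    have "inversions [Closing] = {}" by (auto simp: inversions_def)
    then show ?thesis by (simp add: card_inversions_append card_inversions_Cons)
  qed
  moreover have "nodes (PR_Node ts) choose 2 = ?n + (?n choose 2)"
    by (simp add: nodes_PR_Node numeral_2_eq_2)
  moreover have "?n = sum_list (map (\<lambda>t. level_nodes t True) ts) + sum_list (map (\<lambda>t. level_nodes t False) ts)"
    by (induction ts) (simp_all add: nodes_def)
  moreover have "level_nodes (PR_Node ts) False = sum_list (map (\<lambda>t. level_nodes t True) ts)"
    by (simp add: comp_def)
  ultimately have "card (inversions (bracket_code (PR_Node ts))) + (nodes (PR_Node ts) choose 2)
      + level_nodes (PR_Node ts) False =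
    (card (inversions ?w) + (?n choose 2) + sum_list (map (\<lambda>t. level_nodes t False) ts))
      + 2 * sum_list (map (\<lambda>t. level_nodes t True) ts)" by linarith
  with \<open>even (card (inversions ?w) + _ + _)\<close> show ?case
    by (simp only: even_add dvd_triv_left simp_thms)
qed

section \<open>Forests\<close>

definition adj :: "'v set set \<Rightarrow> ('v \<times> 'v) set" where
  "adj F = {(x, y). {x, y} \<in> F}"

definition reach :: "'v set set \<Rightarrow> 'v \<Rightarrow> 'v set" where
  "reach F w = {x. (w, x) \<in> (adj F)\<^sup>*}"

lemma reach_refl [simp]: "w \<in> reach F w"
  by (simp add: reach_def)

lemma reach_step: "x \<in> reach F w \<Longrightarrow> {x, y} \<in> F \<Longrightarrow> y \<in> reach F w"
  by (auto simp: reach_def adj_def intro: rtrancl_into_rtrancl)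

lemma reach_induct [consumes 1, case_names refl step]:
  assumes "x \<in> reach F w" and "P w"
    and "\<And>y z. y \<in> reach F w \<Longrightarrow> {y, z} \<in> F \<Longrightarrow> P y \<Longrightarrow> P z"
  shows "P x"
proof -
  have "(w, x) \<in> (adj F)\<^sup>*" using assms(1) by (simp add: reach_def)
  then show ?thesis
    by (induction rule: rtrancl_induct) (use assms(2,3) in \<open>auto simp: reach_def adj_def\<close>)
qed

lemma reach_sym:
  assumes "x \<in> reach F w"
  shows "w \<in> reach F x"
proof -
  have "sym (adj F)" by (auto simp: adj_def sym_def insert_commute)
  then show ?thesis using assms unfolding reach_def by (auto dest: sym_rtrancl[THEN symD])
qed

lemma reach_trans: "x \<in> reach F w \<Longrightarrow> y \<in> reach F x \<Longrightarrow> y \<in> reach F w"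
  by (simp add: reach_def)

lemma reach_mono: "F \<subseteq> G \<Longrightarrow> reach F w \<subseteq> reach G w"
  unfolding reach_def using rtrancl_mono[of "adj F" "adj G"] by (auto simp: adj_def)

text \<open>A walk becomes a path by working from its front: if the new first vertex already occurs,
  the path is cut to start there. The distinctness serves to build a
  \<open>graph_cycle\<close>.\<close>

lemma reach_path:
  assumes "v \<in> reach F u"
  shows "\<exists>vs. vs \<noteq> [] \<and> distinct vs \<and> hd vs = u \<and> last vs = v \<and> successively (\<lambda>x y. {x, y} \<in> F) vs"
proof -
  have "(u, v) \<in> (adj F)\<^sup>*" using assms by (simp add: reach_def)
  then show ?thesis
  proof (induction rule: converse_rtrancl_induct)
    case base
    show ?case by (intro exI[of _ "[v]"]) simp
  next
    case (step u u')
    then obtain vs where vs: "vs \<noteq> []" "distinct vs" "hd vs = u'" "last vs = v"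
      "successively (\<lambda>x y. {x, y} \<in> F) vs" by blast
    show ?case
    proof (cases "u \<in> set vs")
      case True
      then obtain ys zs where "vs = ys @ u # zs" by (meson split_list)
      with vs show ?thesis
        by (intro exI[of _ "u # zs"]) (auto simp: successively_append_iff)
    next
      case False
      with vs step.hyps(1) show ?thesis
        by (intro exI[of _ "u # vs"]) (auto simp: successively_Cons adj_def)
    qed
  qed
qed

text \<open>Acyclicity in the form that every edge is a bridge.\<close>

definition forest :: "'v set set \<Rightarrow> bool" where
  "forest E \<longleftrightarrow> (\<forall>u v. {u, v} \<in> E \<longrightarrow> u \<noteq> v \<and> v \<notin> reach (E - {{u, v}}) u)"

lemma forestD:
  assumes "forest E" "{u, v} \<in> E"
  shows "u \<noteq> v" "v \<notin> reach (E - {{u, v}}) u"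
  using assms by (auto simp: forest_def)

text \<open>A path joining the ends of a deleted edge closes up with that edge to a cycle.\<close>

lemma no_graph_cycle_imp_forest:
  assumes "simple_graph V E" "\<nexists>vs. graph_cycle E vs"
  shows "forest E"
  unfolding forest_def
proof (intro allI impI conjI notI)
  fix u v assume uv: "{u, v} \<in> E"
  show neq: False if "u = v"
    using assms(1) uv that by (fastforce simp: simple_graph_def doubleton_eq_iff)
  assume "v \<in> reach (E - {{u, v}}) u"
  then obtain vs where vs: "vs \<noteq> []" "distinct vs" "hd vs = u" "last vs = v"
    "successively (\<lambda>x y. {x, y} \<in> E - {{u, v}}) vs"
    using reach_path by metis
  have step: "{vs ! i, vs ! Suc i} \<in> E - {{u, v}}" if "Suc i < length vs" for i
    using vs(5) that unfolding successively_conv_nth by blast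
  have ends: "vs ! 0 = u" "vs ! (length vs - 1) = v"
    using vs(1,3,4) by (simp_all add: hd_conv_nth last_conv_nth)
  \<comment> \<open>Length 1 would identify the ends, and length 2 would use the deleted edge
    itself.\<close>
  have "length vs \<noteq> 1" using ends neq by auto
  moreover have "length vs \<noteq> 2" using ends step[of 0] by auto
  moreover have "length vs \<noteq> 0" using vs(1) by simp
  ultimately have "3 \<le> length vs" by linarith
  moreover have "{vs ! i, vs ! (Suc i mod length vs)} \<in> E" if "i < length vs" for i
  proof (cases "Suc i = length vs")
    case True
    then have "i = length vs - 1" by simp
    with True have "vs ! i = v" "vs ! (Suc i mod length vs) = u" using ends by auto
    then show ?thesis using uv by (simp add: insert_commute)
  next
    case False
    then show ?thesis using that step[of i] by simp
  qed
  ultimately show False using assms(2) vs(2) unfolding graph_cycle_def by blast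
qed

text \<open>Edges are inserted one by one. If the new edge joins equal colours, the old component of
  one end is recoloured; the edge is a bridge of \<open>E\<close>, so its other end lies outside
  that component.\<close>

lemma forest_2_colourable:
  assumes "forest E" "finite F" "F \<subseteq> E"
  shows "\<exists>c :: 'v \<Rightarrow> bool. \<forall>x y. {x, y} \<in> F \<longrightarrow> c x \<noteq> c y"
  using assms(2,3)
proof (induction F rule: finite_induct)
  case (insert e F)
  then obtain c :: "'v \<Rightarrow> bool" where c: "\<And>x y. {x, y} \<in> F \<Longrightarrow> c x \<noteq> c y" by blast
  show ?case
  proof (cases "\<exists>u v. e = {u, v} \<and> c u = c v")
    case False
    then show ?thesis using c by (intro exI[of _ c]) blast
  next
    case True
    then obtain u v where uv: "e = {u, v}" "c u = c v" by blast
    have "F \<subseteq> E - {{u, v}}" using insert uv by auto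
    then have v: "v \<notin> reach F u"
      using forestD(2)[OF assms(1), of u v] insert.prems uv by (metis insert_subset reach_mono subsetD)
    define c' where "c' x = (if x \<in> reach F u then \<not> c x else c x)" for x
    have "c' x \<noteq> c' y" if xy: "{x, y} \<in> insert e F" for x y
    proof (cases "{x, y} \<in> F")
      case True
      then have "x \<in> reach F u \<longleftrightarrow> y \<in> reach F u"
        by (metis reach_step insert_commute)
      then show ?thesis using c[OF True] by (simp add: c'_def)
    next
      case False
      then have "{x, y} = {u, v}" using xy uv by simp
      then have "x = u \<and> y = v \<or> x = v \<and> y = u" by (simp add: doubleton_eq_iff)
      then show ?thesis using uv v by (auto simp: c'_def)
    qed
    then show ?thesis by blast
  qed
qed simp

section \<open>Branches of a forest at a vertex\<close>

definition star :: "'v set set \<Rightarrow> 'v \<Rightarrow> 'v set set" where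
  "star E w = {e \<in> E. w \<in> e}"

text \<open>The branch hanging from \<open>w\<close> along \<open>e\<close>. As \<open>e\<close> is
  a set, its far end has to be quantified.\<close>

definition beyond :: "'v set set \<Rightarrow> 'v \<Rightarrow> 'v set \<Rightarrow> 'v set" where
  "beyond E w e = {x. \<exists>w'. w' \<noteq> w \<and> e = {w, w'} \<and> x \<in> reach (E - {e}) w'}"

lemma beyond_doubleton: "w' \<noteq> w \<Longrightarrow> beyond E w {w, w'} = reach (E - {{w, w'}}) w'"
  by (auto simp: beyond_def doubleton_eq_iff)

text \<open>The edge is a bridge, so a walk in the branch never meets \<open>w\<close> and uses no
  edge there. Deleting the whole star gives one graph in which different branches can be
  compared.\<close>

lemma reach_avoids:
  assumes "forest E" "{w, w'} \<in> E" "x \<in> reach (E - {{w, w'}}) w'"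
  shows "x \<in> reach (E - star E w) w'"
  using assms(3)
proof (induction rule: reach_induct)
  case refl
  show ?case by simp
next
  case (step y z)
  have not_w: "w \<notin> reach (E - {{w, w'}}) w'"
    using forestD(2)[OF assms(1), of w' w] assms(2) by (simp add: insert_commute)
  then have "y \<noteq> w" "z \<noteq> w" using step.hyps reach_step by metis+
  then have "{y, z} \<in> E - star E w" using step.hyps(2) by (auto simp: star_def)
  then show ?case using step.IH reach_step by metis
qed

lemma not_in_beyond:
  assumes "forest E" "e \<in> E"
  shows "w \<notin> beyond E w e"
  using forestD(2)[OF assms(1)] assms(2) by (auto simp: beyond_def insert_commute)

text \<open>A common vertex would connect the far ends \<open>u\<close> and \<open>v\<close> away
  from \<open>w\<close>; then \<open>e'\<close> leads back to \<open>w\<close> without using the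
  bridge \<open>e\<close>.\<close>

lemma beyond_disjoint:
  assumes "forest E" "e \<in> E" "e' \<in> E" "e \<noteq> e'"
  shows "beyond E w e \<inter> beyond E w e' = {}"
proof (rule ccontr)
  assume "\<not> ?thesis"
  then obtain x u v where u: "u \<noteq> w" "e = {w, u}" "x \<in> reach (E - {e}) u"
    and v: "v \<noteq> w" "e' = {w, v}" "x \<in> reach (E - {e'}) v"
    by (auto simp: beyond_def)
  have "x \<in> reach (E - star E w) u" "x \<in> reach (E - star E w) v"
    using reach_avoids[OF assms(1)] u v assms(2,3) by auto
  then have "v \<in> reach (E - star E w) u" using reach_sym reach_trans by metis
  moreover have "E - star E w \<subseteq> E - {e}" using u by (auto simp: star_def)
  ultimately have "v \<in> reach (E - {e}) u" by (metis reach_mono subsetD)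
  moreover have "{v, w} \<in> E - {e}" using v assms by (simp add: insert_commute)
  ultimately have "w \<in> reach (E - {e}) u" by (rule reach_step)
  then have "w \<in> beyond E w e" using u by (auto simp: beyond_def)
  then show False using not_in_beyond[OF assms(1,2)] by blast
qed

text \<open>\<open>F\<close> serves two cases: empty at the root, the parent edge at any other
  vertex. A step from a branch stays in it or arrives at \<open>w\<close>, and a step from
  \<open>w\<close> enters a branch.\<close>

lemma reach_decompose:
  assumes "forest E" and edges: "\<And>e. e \<in> E \<Longrightarrow> \<exists>x y. e = {x, y}" and "F \<subseteq> star E w"
  shows "reach (E - F) w = insert w (\<Union>e\<in>star E w - F. beyond E w e)" (is "_ = ?R")
proof (intro equalityI subsetI)
  fix x assume "x \<in> reach (E - F) w"
  then show "x \<in> ?R"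
  proof (induction rule: reach_induct)
    case refl
    show ?case by simp
  next
    case (step y z)
    from step.IH consider "y = w" | "z = w"
      | e where "y \<noteq> w" "z \<noteq> w" "e \<in> star E w - F" "y \<in> beyond E w e" by blast
    then show ?case
    proof cases
      case 1
      have "{w, z} \<in> star E w - F" "z \<noteq> w"
        using step.hyps(2) 1 forestD(1)[OF assms(1)] by (auto simp: star_def)
      moreover have "z \<in> beyond E w {w, z}" using \<open>z \<noteq> w\<close> by (simp add: beyond_doubleton)
      ultimately show ?thesis by blast
    next
      case (3 e)
      then have "{y, z} \<in> E - {e}" using step.hyps(2) by (auto simp: star_def)
      then have "z \<in> beyond E w e" using 3(4) reach_step by (fastforce simp: beyond_def)
      then show ?thesis using 3 by blast
    qed simp
  qed
next
  fix x assume "x \<in> ?R"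
  then consider "x = w" | e where "e \<in> star E w - F" "x \<in> beyond E w e" by blast
  then show "x \<in> reach (E - F) w"
  proof cases
    case (2 e)
    then obtain u where u: "u \<noteq> w" "e = {w, u}" "x \<in> reach (E - {e}) u"
      by (auto simp: beyond_def)
    have "x \<in> reach (E - star E w) u"
      using reach_avoids[OF assms(1)] u 2(1) by (auto simp: star_def)
    moreover have "E - star E w \<subseteq> E - F" using assms(3) by blast
    ultimately have "x \<in> reach (E - F) u" by (metis reach_mono subsetD)
    moreover have "u \<in> reach (E - F) w"
      using reach_step[of w "E - F" w u] u 2(1) by (auto simp: star_def)
    ultimately show ?thesis using reach_trans by metis
  qed simp
qed

section \<open>Parity of plane trees\<close>

text \<open>The recursion step shared by the root and the other vertices. Having the colour of
  \<open>w\<close> corresponds to even depth below \<open>w\<close>.\<close>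

lemma level_nodes_children:
  fixes E :: "'v set set" and c :: "'v \<Rightarrow> bool"
  assumes forest: "forest E" and edges: "\<And>e. e \<in> E \<Longrightarrow> \<exists>x y. e = {x, y}"
    and F: "F \<subseteq> star E w" and fin: "finite (reach (E - F) w)"
    and c: "\<And>x y. {x, y} \<in> E \<Longrightarrow> c x \<noteq> c y"
    and es: "distinct es" "set es = star E w - F"
    and ts: "list_all2 (\<lambda>e t. \<exists>w'. w' \<noteq> w \<and> e = {w, w'} \<and>
      (\<forall>k. level_nodes t k = card {x \<in> reach (E - {e}) w'. (c x = c w') = k})) es ts"
  shows "level_nodes (PR_Node ts) k = card {x \<in> reach (E - F) w. (c x = c w) = k}"
proof -
  define B where "B e = {x \<in> beyond E w e. (c x = c w) = k}" for e
  have decompose: "reach (E - F) w = insert w (\<Union>e\<in>set es. beyond E w e)"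
    unfolding es(2) by (rule reach_decompose[OF forest edges F])
  have E: "e \<in> E" if "e \<in> set es" for e using that es(2) by (auto simp: star_def)
  \<comment> \<open>The vertex \<open>w\<close> has its own colour, so it is counted exactly for
    \<open>k = True\<close>.\<close>
  have "{x \<in> reach (E - F) w. (c x = c w) = k} = (if k then {w} else {}) \<union> (\<Union>e\<in>set es. B e)"
    unfolding decompose by (auto simp: B_def)
  moreover have finB: "finite (B e)" if "e \<in> set es" for e
  proof (rule finite_subset[OF _ fin])
    show "B e \<subseteq> reach (E - F) w" unfolding decompose using that by (auto simp: B_def)
  qed
  moreover have "w \<notin> (\<Union>e\<in>set es. B e)"
    using not_in_beyond[OF forest E] by (auto simp: B_def)
  ultimately have "card {x \<in> reach (E - F) w. (c x = c w) = k} =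
      of_bool k + card (\<Union>e\<in>set es. B e)"
    by auto
  also have "card (\<Union>e\<in>set es. B e) = (\<Sum>e\<in>set es. card (B e))"
  proof (rule card_UN_disjoint)
    show "\<forall>e\<in>set es. \<forall>e'\<in>set es. e \<noteq> e' \<longrightarrow> B e \<inter> B e' = {}"
      using beyond_disjoint[OF forest E E] unfolding B_def by blast
  qed (use finB in auto)
  also have "\<dots> = sum_list (map (\<lambda>e. card (B e)) es)"
    using es(1) by (simp add: sum_list_distinct_conv_sum_set)
  also have "map (\<lambda>e. card (B e)) es = map (\<lambda>t. level_nodes t (\<not> k)) ts"
  proof -
    have "list_all2 (\<lambda>e t. card (B e) = level_nodes t (\<not> k)) es ts"
      using ts
    proof (rule list.rel_mono_strong)
      fix e t assume e: "e \<in> set es" and "\<exists>w'. w' \<noteq> w \<and> e = {w, w'} \<and>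
        (\<forall>k. level_nodes t k = card {x \<in> reach (E - {e}) w'. (c x = c w') = k})"
      then obtain w' where w': "w' \<noteq> w" "e = {w, w'}"
        "\<And>k. level_nodes t k = card {x \<in> reach (E - {e}) w'. (c x = c w') = k}" by blast
      \<comment> \<open>A child has the other colour, so the same vertices are counted with
        \<open>\<not> k\<close> when seen from it.\<close>
      have "c w = (\<not> c w')" using c E[OF e] w'(2) by blast
      then have "B e = {x \<in> reach (E - {e}) w'. (c x = c w') = (\<not> k)}"
        unfolding B_def w'(2) beyond_doubleton[OF w'(1)] by (intro Collect_cong conj_cong refl) argo
      then show "card (B e) = level_nodes t (\<not> k)" using w'(3) by simp
    qed
    then show ?thesis by (simp add: list_all2_conv_all_nth list_eq_iff_nth_eq)
  qed
  finally show ?thesis by (simp add: comp_def)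
qed

lemma incident_eq_star: "incident T v = star (edges T) v"
  by (simp add: incident_def star_def)

locale plane_tree_graph =
  fixes T :: "('v, 'm) plane_graph_scheme"
  assumes plane_tree: "plane_tree T"
begin

lemma finite_verts: "finite (verts T)"
  and simple: "simple_graph (verts T) (edges T)"
  and connected: "connected_graph (verts T) (edges T)"
  and acyclic: "\<nexists>vs. graph_cycle (edges T) vs"
  using plane_tree by (auto simp: plane_tree_def finite_tree_def)

lemma edgeE:
  assumes "e \<in> edges T"
  obtains u v where "e = {u, v}" "u \<noteq> v" "u \<in> verts T" "v \<in> verts T"
  using simple assms unfolding simple_graph_def by blast

lemma in_edge_verts: "e \<in> edges T \<Longrightarrow> v \<in> e \<Longrightarrow> v \<in> verts T"
  by (elim edgeE) auto

lemma finite_edges: "finite (edges T)"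
proof (rule finite_subset)
  show "edges T \<subseteq> Pow (verts T)" using in_edge_verts by blast
qed (simp add: finite_verts)

lemma forest_edges: "forest (edges T)"
  by (rule no_graph_cycle_imp_forest[OF simple acyclic])

lemma cyclic_incident: "e \<in> incident T v \<Longrightarrow> cyclic_on (nxt T v) (incident T v)"
  using plane_tree in_edge_verts unfolding plane_tree_def incident_def by blast

lemma reach_edges:
  assumes "v \<in> verts T"
  shows "reach (edges T) v = verts T"
proof (intro equalityI subsetI)
  fix x assume "x \<in> reach (edges T) v"
  then show "x \<in> verts T"
    by (induction rule: reach_induct) (use assms in_edge_verts in auto)
next
  fix x assume "x \<in> verts T"
  then show "x \<in> reach (edges T) v"
    using connected assms by (simp add: connected_graph_def reach_def adj_def)
qed

lemma reach_subset_verts: "v \<in> verts T \<Longrightarrow> reach (edges T - F) v \<subseteq> verts T"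
  using reach_mono[of "edges T - F" "edges T" v] reach_edges by blast

text \<open>\<open>es 0\<close> lists the child edges at the root, beginning with the marked edge;
  \<open>es 1\<close> lists them at other vertices, where \<open>e\<close> leads to the parent and
  is skipped.\<close>

lemma incident_enumeration:
  assumes "e \<in> incident T v"
  defines "es k \<equiv> map (\<lambda>i. (nxt T v ^^ i) e) [k..<card (incident T v)]"
  shows "distinct (es k)" "set (es 0) = incident T v" "set (es 1) = incident T v - {e}"
proof -
  let ?f = "\<lambda>i. (nxt T v ^^ i) e" and ?d = "card (incident T v)"
  have bij: "bij_betw ?f {0..<?d} (incident T v)"
    by (rule cyclic_on_enumeration(1)[OF cyclic_incident[OF assms(1)] assms(1)])
  then have inj: "inj_on ?f {0..<?d}" by (simp add: bij_betw_def)
  show "distinct (es k)"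
    using inj_on_subset[OF inj, of "{k..<?d}"] by (auto simp: es_def distinct_map)
  show es0: "set (es 0) = incident T v" using bij by (simp add: es_def bij_betw_def)
  have "?d > 0" using es0 assms(1) by (auto simp: es_def)
  then have "es 0 = e # es 1" by (simp add: es_def upt_conv_Cons)
  moreover have "distinct (es 0)" using inj by (auto simp: es_def distinct_map)
  ultimately show "set (es 1) = incident T v - {e}" using es0 by auto
qed

section \<open>Depth parity as a proper 2-colouring\<close>

context
  fixes c :: "'v \<Rightarrow> bool"
  assumes proper: "\<And>x y. {x, y} \<in> edges T \<Longrightarrow> c x \<noteq> c y"
begin

text \<open>Without its parent edge, the component of \<open>w\<close> consists of \<open>w\<close>
  and its descendants; depth parity and colour both change along every edge.\<close>

lemma level_nodes_pr_branch:
  assumes "pr_branch T w e t" "e \<in> incident T w"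
  shows "level_nodes t k = card {x \<in> reach (edges T - {e}) w. (c x = c w) = k}"
  using assms
proof (induction arbitrary: k rule: pr_branch.induct)
  case (1 w e ts)
  let ?es = "map (\<lambda>i. (nxt T w ^^ i) e) [1..<card (incident T w)]"
  have w: "w \<in> verts T" using 1(2) in_edge_verts by (auto simp: incident_def)
  show ?case
  proof (rule level_nodes_children[OF forest_edges])
    show "{e} \<subseteq> star (edges T) w" using 1(2) by (simp add: incident_eq_star)
    show "finite (reach (edges T - {e}) w)"
      using reach_subset_verts[OF w] finite_verts finite_subset by blast
    show "distinct ?es" "set ?es = star (edges T) w - {e}"
      using incident_enumeration[OF 1(2)] by (simp_all only: incident_eq_star)
    show "list_all2 (\<lambda>e t. \<exists>w'. w' \<noteq> w \<and> e = {w, w'} \<and>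
        (\<forall>k. level_nodes t k = card {x \<in> reach (edges T - {e}) w'. (c x = c w') = k})) ?es ts"
      using 1(1)
    proof (rule list.rel_mono_strong, elim exE conjE)
      fix e' t' w'
      assume e': "e' \<in> set ?es" "e' = {w, w'}" "w' \<noteq> w"
        and IH: "e' \<in> incident T w' \<longrightarrow>
          (\<forall>k. level_nodes t' k = card {x \<in> reach (edges T - {e'}) w'. (c x = c w') = k})"
      have "e' \<in> incident T w'"
        using e' incident_enumeration(3)[OF 1(2)] by (auto simp: incident_def)
      then show "\<exists>w'. w' \<noteq> w \<and> e' = {w, w'} \<and>
          (\<forall>k. level_nodes t' k = card {x \<in> reach (edges T - {e'}) w'. (c x = c w') = k})"
        using e' IH by blast
    qed
  qed (use edgeE proper in blast)+
qed

lemma level_nodes_pr_tree_of: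
  assumes "pr_tree_of T r e t"
  shows "level_nodes t k = card {x \<in> verts T. (c x = c r) = k}"
proof -
  let ?es = "map (\<lambda>i. (nxt T r ^^ i) e) [0..<card (incident T r)]"
  have r: "r \<in> verts T" and e: "e \<in> incident T r"
    and children: "list_all2 (\<lambda>e' t'. \<exists>w'. w' \<noteq> r \<and> e' = {r, w'} \<and> pr_branch T w' e' t')
      ?es (pr_subtrees t)"
    using assms by (auto simp: pr_tree_of_def)
  have "level_nodes (PR_Node (pr_subtrees t)) k = card {x \<in> reach (edges T - {}) r. (c x = c r) = k}"
  proof (rule level_nodes_children[OF forest_edges])
    show "finite (reach (edges T - {}) r)"
      using reach_subset_verts[OF r] finite_verts finite_subset by blast
    show "distinct ?es" "set ?es = star (edges T) r - {}"
      using incident_enumeration[OF e] by (simp_all only: incident_eq_star Diff_empty)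
    show "list_all2 (\<lambda>e t. \<exists>w'. w' \<noteq> r \<and> e = {r, w'} \<and>
        (\<forall>k. level_nodes t k = card {x \<in> reach (edges T - {e}) w'. (c x = c w') = k}))
        ?es (pr_subtrees t)"
      using children
    proof (rule list.rel_mono_strong, elim exE conjE)
      fix e' t' w'
      assume e': "e' \<in> set ?es" "e' = {r, w'}" "w' \<noteq> r" and "pr_branch T w' e' t'"
      moreover have "e' \<in> incident T w'"
        using e' incident_enumeration(2)[OF e] by (auto simp: incident_def)
      ultimately show "\<exists>w'. w' \<noteq> r \<and> e' = {r, w'} \<and>
          (\<forall>k. level_nodes t' k = card {x \<in> reach (edges T - {e'}) w'. (c x = c w') = k})"
        using level_nodes_pr_branch by blast
    qed
  qed (use edgeE proper in blast)+
  then show ?thesis by (simp add: reach_edges[OF r])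
qed

lemma card_verts_colour:
  "card {x \<in> verts T. c x} + card {x \<in> verts T. \<not> c x} = card (verts T)"
  using finite_verts by (subst card_Un_disjoint[symmetric]) (auto intro: arg_cong[of _ _ card])

text \<open>The colour of the root decides which class lies at odd depth, but for an even number of
  vertices both classes have the same parity. In particular the result does not depend on root and
  marked edge.\<close>

lemma inversions_parity:
  assumes "pr_tree_of T r e t" "even (card (verts T))"
  shows "even (card (inversions (bracket_code t))) \<longleftrightarrow>
    even ((card (verts T) choose 2) + card {x \<in> verts T. c x})"
proof -
  let ?p = "card {x \<in> verts T. c x}" and ?q = "card {x \<in> verts T. \<not> c x}"
  have "level_nodes t True = ?p \<and> level_nodes t False = ?q \<or>
        level_nodes t True = ?q \<and> level_nodes t False = ?p"
    using level_nodes_pr_tree_of[OF assms(1), of True] level_nodes_pr_tree_of[OF assms(1), of False]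
    by (cases "c r") simp_all
  moreover have "even ?p \<longleftrightarrow> even ?q" using card_verts_colour assms(2) by presburger
  moreover have "nodes t = card (verts T)"
    using calculation(1) card_verts_colour by (auto simp: nodes_def)
  ultimately show ?thesis using inversions_bracket_code_parity[of t] by auto
qed

end

end

section \<open>The rotation group of a clean tree\<close>

text \<open>\<open>h\<close> has only one end in \<open>C\<close> and \<open>f\<close> is injective,
  so the description in \<open>colour_perm\<close> has a single candidate.\<close>

lemma colour_perm_apply:
  assumes "inj_on f (edges B)" "x \<in> C" "h \<in> incident B x"
    and "\<And>y. y \<in> C \<Longrightarrow> h \<in> incident B y \<Longrightarrow> y = x"
  shows "colour_perm B C f (f h) = f (nxt B x h)"
proof -
  have "f h \<in> f ` edges B" using assms(3) by (auto simp: incident_def)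
  moreover have "(THE j. \<exists>v\<in>C. \<exists>e\<in>incident B v. f e = f h \<and> f (nxt B v e) = j) = f (nxt B x h)"
  proof (rule the_equality)
    show "\<exists>v\<in>C. \<exists>e\<in>incident B v. f e = f h \<and> f (nxt B v e) = f (nxt B x h)"
      using assms by blast
  next
    fix j assume "\<exists>v\<in>C. \<exists>e\<in>incident B v. f e = f h \<and> f (nxt B v e) = j"
    then obtain v e where ve: "v \<in> C" "e \<in> incident B v" "f e = f h" "f (nxt B v e) = j" by blast
    then have "e = h" using assms(1,3) by (auto simp: incident_def dest: inj_onD)
    then show "j = f (nxt B x h)" using ve assms(4) by blast
  qed
  ultimately show ?thesis by (simp add: colour_perm_def)
qed

lemma colour_perm_outside: "i \<notin> f ` edges B \<Longrightarrow> colour_perm B C f i = i"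
  by (simp add: colour_perm_def)

section \<open>Incidence and rotation in a clean tree\<close>

lemma edges_clean_tree: "edges (clean_tree T) = {{Inl v, Inr e} | v e. e \<in> incident T v}"
  by (auto simp: clean_tree_def incident_def)

lemma incident_clean_tree_Inl:
  "incident (clean_tree T) (Inl v) = (\<lambda>e. {Inl v, Inr e}) ` incident T v"
  unfolding incident_def[of "clean_tree T"] edges_clean_tree by auto

lemma incident_clean_tree_Inr:
  "e \<in> edges T \<Longrightarrow> incident (clean_tree T) (Inr e) = (\<lambda>v. {Inl v, Inr e}) ` e"
  unfolding incident_def[of "clean_tree T"] edges_clean_tree by (auto simp: incident_def)

lemma nxt_clean_tree_Inl: "nxt (clean_tree T) (Inl v) {Inl v, Inr e} = {Inl v, Inr (nxt T v e)}"
  by (simp add: clean_tree_def)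

lemma nxt_clean_tree_Inr:
  assumes "u \<noteq> v"
  shows "nxt (clean_tree T) (Inr {u, v}) {Inl u, Inr {u, v}} = {Inl v, Inr {u, v}}"
proof -
  have "(THE x. x \<in> {u, v} \<and> Inl x \<notin> {Inl u, Inr {u, v}}) = v"
    using assms by (intro the_equality) auto
  then show ?thesis by (simp add: clean_tree_def)
qed

lemma white_clean_tree: "white (clean_tree T) = Inl ` verts T"
  by (simp add: clean_tree_def)

lemma black_clean_tree: "black (clean_tree T) = Inr ` edges T"
  by (auto simp: clean_tree_def black_def)

locale enumerated_clean_tree = plane_tree_graph T
  for T :: "('v, 'm) plane_graph_scheme" +
  fixes f :: "('v + 'v set) set \<Rightarrow> nat" and n :: nat
  assumes card_verts: "card (verts T) = n" and even_n: "even n"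
    and enumeration: "bij_betw f (edges (clean_tree T)) {1..2 * n - 2}"
begin

abbreviation M where "M \<equiv> {1..2 * n - 2}"

text \<open>The number of the half of \<open>e\<close> at \<open>v\<close>: edges of the clean tree
  correspond to edges of \<open>T\<close> with a chosen end.\<close>

definition dart where "dart v e = f {Inl v, Inr e}"

definition darts where "darts v = dart v ` incident T v"

definition rot_white where "rot_white = colour_perm (clean_tree T) (white (clean_tree T)) f"

definition rot_black where "rot_black = colour_perm (clean_tree T) (black (clean_tree T)) f"

section \<open>The two generators acting on darts\<close>

lemma inj_enumeration: "inj_on f (edges (clean_tree T))"
  and image_enumeration: "f ` edges (clean_tree T) = M"
  using enumeration by (auto simp: bij_betw_def)

lemma incident_verts: "e \<in> incident T v \<Longrightarrow> v \<in> verts T"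
  using in_edge_verts by (auto simp: incident_def)

lemma dart_inj:
  assumes "e \<in> incident T v" "e' \<in> incident T v'" "dart v e = dart v' e'"
  shows "v = v' \<and> e = e'"
proof -
  have "{Inl v, Inr e} = ({Inl v', Inr e'} :: ('v + 'v set) set)"
    using inj_enumeration assms unfolding dart_def edges_clean_tree
    by (intro inj_onD[OF inj_enumeration]) (auto simp: edges_clean_tree)
  then show ?thesis by (simp add: doubleton_eq_iff)
qed

lemma M_eq: "M = (\<Union>v\<in>verts T. darts v)"
  unfolding image_enumeration[symmetric] edges_clean_tree darts_def dart_def
  using incident_verts by auto

lemma rot_white_dart:
  assumes "e \<in> incident T v"
  shows "rot_white (dart v e) = dart v (nxt T v e)"
  unfolding rot_white_def dart_def nxt_clean_tree_Inl[symmetric]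
proof (rule colour_perm_apply[OF inj_enumeration])
  show "Inl v \<in> white (clean_tree T)" using incident_verts[OF assms] by (simp add: white_clean_tree)
  show "{Inl v, Inr e} \<in> incident (clean_tree T) (Inl v)"
    using assms by (simp add: incident_clean_tree_Inl)
  show "y = Inl v" if "y \<in> white (clean_tree T)" "{Inl v, Inr e} \<in> incident (clean_tree T) y" for y
    using that by (auto simp: white_clean_tree incident_def)
qed

text \<open>The set is written \<open>{v, u}\<close> on the right so that the equation can be
  applied again to its result.\<close>

lemma rot_black_dart:
  assumes "{u, v} \<in> edges T"
  shows "rot_black (dart u {u, v}) = dart v {v, u}"
proof -
  have "u \<noteq> v" using assms forestD(1)[OF forest_edges] by blast
  note nxt = nxt_clean_tree_Inr[OF this, of T, symmetric]
  show ?thesis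
    unfolding rot_black_def dart_def insert_commute[of v u "{}"] nxt
  proof (rule colour_perm_apply[OF inj_enumeration])
    show "Inr {u, v} \<in> black (clean_tree T)" using assms by (simp add: black_clean_tree)
    show "{Inl u, Inr {u, v}} \<in> incident (clean_tree T) (Inr {u, v})"
      using assms by (simp add: incident_clean_tree_Inr)
    show "y = Inr {u, v}"
      if "y \<in> black (clean_tree T)" "{Inl u, Inr {u, v}} \<in> incident (clean_tree T) y" for y
      using that by (auto simp: black_clean_tree incident_def)
  qed
qed

lemma cyclic_darts:
  assumes "incident T v \<noteq> {}"
  shows "cyclic_on rot_white (darts v)"
proof -
  have "cyclic_on (nxt T v) (incident T v)" using assms cyclic_incident by blast
  then show ?thesis
    unfolding darts_def by (rule cyclic_on_image) (rule rot_white_dart)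
qed

lemma disjoint_darts: "disjoint_family_on darts V"
  using dart_inj by (auto simp: disjoint_family_on_def darts_def)

text \<open>Evenness excludes the one-vertex tree, the only tree with a vertex that has no
  darts.\<close>

lemma n_ge_2: "n \<ge> 2"
proof -
  have "verts T \<noteq> {}" using connected by (simp add: connected_graph_def)
  then have "n > 0" using card_verts finite_verts by auto
  then show ?thesis using even_n by presburger
qed

lemma incident_nonempty:
  assumes "v \<in> verts T"
  shows "incident T v \<noteq> {}"
proof
  assume empty: "incident T v = {}"
  have "reach (edges T) v \<subseteq> {v}"
  proof
    fix x assume "x \<in> reach (edges T) v"
    then show "x \<in> {v}"
      by (induction rule: reach_induct) (use empty in \<open>auto simp: incident_def\<close>)
  qed
  then have "card (verts T) \<le> card {v}"
    using reach_edges[OF assms] by (intro card_mono) auto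
  then show False using card_verts n_ge_2 by simp
qed

lemma permutes_M:
  assumes "\<And>i. i \<notin> M \<Longrightarrow> p i = i" "p ` M = M"
  shows "p permutes M"
proof (rule bij_imp_permutes)
  show "bij_betw p M M"
    using assms(2) eq_card_imp_inj_on[of M p] by (simp add: bij_betw_def)
qed (rule assms(1))

lemma rot_white_darts: "v \<in> verts T \<Longrightarrow> rot_white ` darts v = darts v"
  using cyclic_on_bij_betw[OF cyclic_darts[OF incident_nonempty]] by (simp add: bij_betw_def)

lemma rot_white_UN: "V \<subseteq> verts T \<Longrightarrow> rot_white ` (\<Union>v\<in>V. darts v) = (\<Union>v\<in>V. darts v)"
  unfolding image_UN using rot_white_darts by (intro SUP_cong) auto

lemma rot_white_permutes: "rot_white permutes M"
proof (rule permutes_M)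
  show "rot_white i = i" if "i \<notin> M" for i
    using that colour_perm_outside unfolding rot_white_def image_enumeration[symmetric] by metis
  show "rot_white ` M = M" unfolding M_eq by (rule rot_white_UN) simp
qed

lemma other_end:
  assumes "e \<in> incident T v"
  obtains u where "e = {v, u}" "u \<noteq> v" "e \<in> incident T u"
proof -
  have e: "e \<in> edges T" "v \<in> e" using assms by (auto simp: incident_def)
  then obtain x y where xy: "e = {x, y}" "x \<noteq> y" by (elim edgeE)
  show thesis
  proof (cases "v = x")
    case True
    then show thesis using that[of y] xy e by (simp add: incident_def)
  next
    case False
    then show thesis using that[of x] xy e by (simp add: incident_def insert_commute)
  qed
qed

lemma rot_black_outside: "i \<notin> M \<Longrightarrow> rot_black i = i"
  using colour_perm_outside unfolding rot_black_def image_enumeration[symmetric] by metis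

lemma in_M_cases:
  assumes "i \<in> M"
  obtains v u where "{v, u} \<in> edges T" "i = dart v {v, u}"
proof -
  obtain v e where "e \<in> incident T v" "i = dart v e"
    using assms unfolding M_eq darts_def by auto
  moreover from this(1) obtain u where "e = {v, u}" by (rule other_end)
  ultimately show thesis using that by (simp add: incident_def)
qed

lemma dart_in_darts: "{v, u} \<in> edges T \<Longrightarrow> dart v {v, u} \<in> darts v"
  by (auto simp: darts_def incident_def)

lemma dart_in_M: "{v, u} \<in> edges T \<Longrightarrow> dart v {v, u} \<in> M"
  unfolding M_eq using dart_in_darts in_edge_verts by blast

lemma rot_black_twice: "rot_black (rot_black i) = i"
proof (cases "i \<in> M")
  case True
  then obtain v u where vu: "{v, u} \<in> edges T" "i = dart v {v, u}" by (rule in_M_cases)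
  then have "{u, v} \<in> edges T" by (simp add: insert_commute)
  then show ?thesis using vu rot_black_dart by simp
qed (simp add: rot_black_outside)

lemma rot_black_in_M: "i \<in> M \<Longrightarrow> rot_black i \<in> M"
proof (erule in_M_cases)
  fix v u assume vu: "{v, u} \<in> edges T" "i = dart v {v, u}"
  then have "{u, v} \<in> edges T" by (simp add: insert_commute)
  then show ?thesis using vu rot_black_dart dart_in_M by simp
qed

lemma rot_black_permutes: "rot_black permutes M"
proof (rule permutes_M)
  show "rot_black ` M = M"
    using rot_black_in_M rot_black_twice by (metis image_subset_iff rev_image_eqI subsetI subset_antisym)
qed (rule rot_black_outside)

text \<open>An invariant set that meets the darts of a vertex contains them all, since
  \<open>rot_white\<close> is one cycle there; \<open>rot_black\<close> then crosses every edge to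
  the neighbours, and \<open>T\<close> is connected.\<close>

lemma rotation_irreducible:
  assumes "S \<subseteq> M" "S \<noteq> {}" "rot_white ` S \<subseteq> S" "rot_black ` S \<subseteq> S"
  shows "S = M"
proof -
  have whole: "darts v \<subseteq> S" if v: "v \<in> verts T" and i: "i \<in> S" "i \<in> darts v" for v i
  proof -
    have "darts v = orbit rot_white i"
      using orbit_cyclic_eq3[OF cyclic_darts[OF incident_nonempty[OF v]] i(2)] by simp
    moreover have "j \<in> S" if "j \<in> orbit rot_white i" for j
      using that by induction (use assms(3) i in auto)
    ultimately show ?thesis by blast
  qed
  obtain i where i: "i \<in> S" using assms(2) by blast
  then obtain r where r: "r \<in> verts T" "i \<in> darts r" using assms(1) M_eq by blast
  have "darts v \<subseteq> S" if "v \<in> reach (edges T) r" for v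
    using that
  proof (induction rule: reach_induct)
    case refl
    show ?case using whole r i by blast
  next
    case (step y z)
    have "dart y {y, z} \<in> S" using step dart_in_darts by blast
    then have "dart z {z, y} \<in> S" using assms(4) rot_black_dart[OF step.hyps(2)] by force
    moreover have "{z, y} \<in> edges T" using step.hyps(2) by (simp add: insert_commute)
    ultimately show ?case using whole dart_in_darts in_edge_verts by blast
  qed
  then show ?thesis using assms(1) reach_edges[OF r(1)] M_eq by blast
qed

section \<open>The rotation group as an instance of two exchanged blocks\<close>

lemma card_edges_clean_tree: "card (edges (clean_tree T)) = 2 * n - 2"
  using bij_betw_same_card[OF enumeration] by simp

lemma rotation_group_eq:
  "rotation_group (clean_tree T) f = generate (sym_group (2 * n - 2)) {rot_white, rot_black}"
  by (simp add: rotation_group_def card_edges_clean_tree rot_white_def rot_black_def)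

text \<open>The block holds the darts at the vertices of one colour. The exponent of its sign is
  \<open>n - 1\<close> plus the number of cycles, and the odd \<open>n - 1\<close> becomes the
  \<open>Suc\<close>.\<close>

lemma swapped_blocks_rotation:
  assumes proper: "\<And>x y. {x, y} \<in> edges T \<Longrightarrow> c x \<noteq> c y"
  shows "swapped_blocks (2 * n - 2) (\<Union>v\<in>{v \<in> verts T. c v}. darts v) rot_white rot_black
    ((-1) ^ Suc (card {v \<in> verts T. c v}))"
proof -
  let ?P = "{v \<in> verts T. c v}" and ?Q = "{v \<in> verts T. \<not> c v}"
  let ?A = "\<Union>v\<in>?P. darts v" and ?B = "\<Union>v\<in>?Q. darts v"
  have disj: "?A \<inter> ?B = {}"
    using disjoint_darts[of UNIV] by (force simp: disjoint_family_on_def)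
  have union: "?A \<union> ?B = M" unfolding M_eq by blast
  have B: "M - ?A = ?B" using disj union by blast
  \<comment> \<open>An edge joins different colours, so \<open>rot_black\<close> changes the colour
    of the vertex; the variable \<open>k\<close> treats both inclusions at once.\<close>
  have swap: "rot_black ` (\<Union>v\<in>{v \<in> verts T. c v = k}. darts v)
      \<subseteq> (\<Union>v\<in>{v \<in> verts T. c v = (\<not> k)}. darts v)" for k
  proof clarify
    fix v i assume v: "v \<in> verts T" "i \<in> darts v" "k = c v"
    then obtain e where e: "e \<in> incident T v" "i = dart v e" by (auto simp: darts_def)
    from e(1) obtain u where u: "e = {v, u}" by (rule other_end)
    then have edge: "{v, u} \<in> edges T" "{u, v} \<in> edges T"
      using e by (simp_all add: incident_def insert_commute)
    then have "rot_black i \<in> darts u"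
      using rot_black_dart dart_in_darts e u by simp
    moreover have "c u = (\<not> c v)" using proper[OF edge(1)] by blast
    moreover have "u \<in> verts T" using edge in_edge_verts by blast
    ultimately show "rot_black i \<in> (\<Union>u\<in>{u \<in> verts T. c u = (\<not> c v)}. darts u)" by blast
  qed
  have "rot_black ` ?A \<subseteq> ?B" "rot_black ` ?B \<subseteq> ?A" using swap[of True] swap[of False] by simp_all
  then have b_block: "rot_black ` ?A = ?B"
    using rot_black_twice by (metis (no_types, lifting) image_subset_iff rev_image_eqI subsetI subset_antisym)
  have fin: "finite ?A" "finite ?B"
    using finite_subset[of _ M] union by blast+
  \<comment> \<open>Exchanged blocks have equal size, and together they exhaust
    \<open>M\<close>.\<close>
  have "card ?A = card ?B"
    unfolding b_block[symmetric]
    by (rule card_image[symmetric, OF inj_on_subset[OF permutes_inj[OF rot_black_permutes] subset_UNIV]])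
  moreover have "card ?A + card ?B = 2 * n - 2"
    using card_Un_disjoint[OF fin disj] union by simp
  ultimately have card: "card ?A = n - 1" "card ?B = n - 1" using n_ge_2 by auto
  have odd: "odd (n - 1)" using n_ge_2 even_n by simp
  have sign: "sign_on (\<Union>v\<in>V. darts v) rot_white = (-1) ^ (card (\<Union>v\<in>V. darts v) + card V)"
    if "V \<subseteq> verts T" for V
    using sign_on_UN_cyclic[of V rot_white darts] that finite_subset[OF that finite_verts]
      cyclic_darts[OF incident_nonempty] disjoint_darts by blast
  have "card ?P + card ?Q = n" using card_verts_colour[OF proper] card_verts by simp
  then have parity: "even (card ?P) \<longleftrightarrow> even (card ?Q)" using even_n by presburger
  show ?thesis
  proof
    show "sign_on ?A rot_white = (-1) ^ Suc (card ?P)"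
      using sign[of ?P] odd unfolding card by (simp add: power_add)
    \<comment> \<open>The complement has \<open>card ?Q\<close> cycles, a number of the same parity
      as \<open>card ?P\<close> because \<open>n\<close> is even.\<close>
    show "sign_on (M - ?A) rot_white = (-1) ^ Suc (card ?P)"
      using sign[of ?Q] odd parity unfolding B card by (simp add: power_add minus_one_power_iff)
    show "rot_black \<circ> rot_black = id" using rot_black_twice by (simp add: fun_eq_iff)
    show "odd (card ?A)" using odd card by simp
    show "rot_black ` ?A = M - ?A" using b_block B by simp
    show "?A \<subseteq> M" using union by blast
    show "rot_white ` ?A = ?A" by (rule rot_white_UN) blast
  qed (use rot_white_permutes rot_black_permutes rotation_irreducible in blast)+
qed

text \<open>Hides the colouring: one number \<open>p\<close> governs both the sign of
  \<open>rot_white\<close> on the blocks and the parity of \<open>T\<close>. Both implications are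
  stated since \<open>odd_plane_tree\<close> is not defined as the negation of
  \<open>even_plane_tree\<close>.\<close>

lemma rotation_blocks:
  obtains A p where
    "swapped_blocks (2 * n - 2) A rot_white rot_black ((-1) ^ Suc p)"
    "even_plane_tree T \<Longrightarrow> even ((n choose 2) + p)"
    "odd_plane_tree T \<Longrightarrow> odd ((n choose 2) + p)"
proof -
  obtain c :: "'v \<Rightarrow> bool" where c: "\<And>x y. {x, y} \<in> edges T \<Longrightarrow> c x \<noteq> c y"
    using forest_2_colourable[OF forest_edges finite_edges subset_refl] by blast
  show thesis
  proof (rule that[OF swapped_blocks_rotation[OF c]])
    show "even ((n choose 2) + card {v \<in> verts T. c v})" if "even_plane_tree T"
      using that inversions_parity[OF c] card_verts even_n
      by (auto simp: even_plane_tree_def even_pr_tree_def)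
    show "odd ((n choose 2) + card {v \<in> verts T. c v})" if "odd_plane_tree T"
      using that inversions_parity[OF c] card_verts even_n
      by (auto simp: odd_plane_tree_def odd_pr_tree_def)
  qed
qed

end

theorem proposition6p1:
  fixes T :: "'v plane_graph" and U :: "'u plane_graph" and n :: nat
    and f :: "('v + 'v set) set \<Rightarrow> nat" and g :: "('u + 'u set) set \<Rightarrow> nat"
  assumes "plane_tree T" and "plane_tree U"
    and "card (verts T) = n" and "card (verts U) = n" and "even n"
    and "(even_plane_tree T \<and> odd_plane_tree U) \<or> (odd_plane_tree T \<and> even_plane_tree U)"
    and "bij_betw f (edges (clean_tree T)) {1..2 * n - 2}"
    and "bij_betw g (edges (clean_tree U)) {1..2 * n - 2}"
  shows "rotation_group (clean_tree T) f \<noteq> rotation_group (clean_tree U) g"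
proof
  assume eq: "rotation_group (clean_tree T) f = rotation_group (clean_tree U) g"
  interpret T: enumerated_clean_tree T f n using assms by unfold_locales auto
  interpret U: enumerated_clean_tree U g n using assms by unfold_locales auto
  obtain A p where T: "swapped_blocks (2 * n - 2) A T.rot_white T.rot_black ((-1) ^ Suc p)"
    "even_plane_tree T \<Longrightarrow> even ((n choose 2) + p)" "odd_plane_tree T \<Longrightarrow> odd ((n choose 2) + p)"
    by (rule T.rotation_blocks) blast
  obtain B q where U: "swapped_blocks (2 * n - 2) B U.rot_white U.rot_black ((-1) ^ Suc q)"
    "even_plane_tree U \<Longrightarrow> even ((n choose 2) + q)" "odd_plane_tree U \<Longrightarrow> odd ((n choose 2) + q)"
    by (rule U.rotation_blocks) blast
  \<comment> \<open>The common term \<open>n choose 2\<close> cancels, so trees of different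
    parities make \<open>p\<close> and \<open>q\<close> differ modulo 2.\<close>
  have parity: "even p \<longleftrightarrow> odd q" using assms(6) T(2,3) U(2,3) by fastforce
  have eq': "generate (sym_group (2 * n - 2)) {T.rot_white, T.rot_black} =
      generate (sym_group (2 * n - 2)) {U.rot_white, U.rot_black}"
    using eq T.rotation_group_eq U.rotation_group_eq by simp
  \<comment> \<open>The odd one of \<open>p\<close> and \<open>q\<close> gives sign 1, and
    \<open>rotation_sign_unique\<close> forces sign 1 on the other tree, whose sign is -1.\<close>
  show False
  proof (cases "odd p")
    case True
    with T(1) have "swapped_blocks (2 * n - 2) A T.rot_white T.rot_black 1" by simp
    from rotation_sign_unique[OF this U(1) eq'] show False
      using parity True by (simp add: minus_one_power_iff)
  next
    case False
    with U(1) parity have "swapped_blocks (2 * n - 2) B U.rot_white U.rot_black 1" by simp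
    from rotation_sign_unique[OF this T(1) eq'[symmetric]] show False
      using False by (simp add: minus_one_power_iff)
  qed
qed

end
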